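(* Let $m,n\ge 2$ be integers. The monoid $G_{m,n}^{+}$ does not always have least common multiples: there exist two elements of $G_{m,n}^{+}$ that have no right least common multiple, and there exist two elements of $G_{m,n}^{+}$ that have no left least common multiple.
   Context: For letters $x_1,\dots,x_k$, the symbol $[x_1,x_2,\dots,x_k]$ denotes the cyclic relations $x_1x_2\cdots x_k=x_2\cdots x_kx_1=x_3\cdots x_kx_1x_2=\cdots=x_kx_1\cdots x_{k-1}$ (all cyclic rotations of the word are equal); in particular $[x,y]$ denotes $xy=yx$. $G_{m,n}^{+}$ is the monoid presented (as a monoid) by the generators $s,t_1,\dots,t_m,u_1,\dots,u_n$ and the relations $[s,t_1,\dots,t_m]$, $[s,u_1,\dots,u_n]$, and $[t_i,u_j]$ for all $1\le i\le m$, $1\le j\le n$. In a monoid $M$, $U$ divides $V$ from the left (resp. right) if $V=UW$ (resp. $V=WU$) for some $W\in M$; then $V$ is a right-multiple (resp. left-multiple) of $U$. A right (resp. left) least common multiple of $U,V\in M$ is an element that is a common right-multiple (resp. left-multiple) of $U$ and $V$ and that divides from the left (resp. right) every other common right-multiple (resp. left-multiple) of $U$ and $V$. *)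

theory Defs
  imports "HOL-Algebra.Divisibility"
begin

inductive word_cong :: "'a set \<Rightarrow> ('a list \<times> 'a list) set \<Rightarrow> 'a list \<Rightarrow> 'a list \<Rightarrow> bool"
  for A R where
  rel: "\<lbrakk>(u, v) \<in> R; u \<in> lists A; v \<in> lists A; p \<in> lists A; q \<in> lists A\<rbrakk>
          \<Longrightarrow> word_cong A R (p @ u @ q) (p @ v @ q)"
| refl: "w \<in> lists A \<Longrightarrow> word_cong A R w w"
| sym: "word_cong A R u v \<Longrightarrow> word_cong A R v u"
| trans: "\<lbrakk>word_cong A R u v; word_cong A R v w\<rbrakk> \<Longrightarrow> word_cong A R u w"

definition word_class :: "'a set \<Rightarrow> ('a list \<times> 'a list) set \<Rightarrow> 'a list \<Rightarrow> 'a list set" where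
  "word_class A R w = {v. word_cong A R w v}"

text \<open>
  The product is the union of the classes of all concatenations of representatives;
  by \<open>presented_monoid_mult\<close> below these classes all coincide.
\<close>

definition presented_monoid :: "'a set \<Rightarrow> ('a list \<times> 'a list) set \<Rightarrow> 'a list set monoid" where
  "presented_monoid A R =
     \<lparr>carrier = word_class A R ` lists A,
      mult = (\<lambda>X Y. \<Union>x\<in>X. \<Union>y\<in>Y. word_class A R (x @ y)),
      one = word_class A R []\<rparr>"

lemma word_cong_in_lists:
  "word_cong A R u v \<Longrightarrow> u \<in> lists A \<and> v \<in> lists A"
  by (induction rule: word_cong.induct) auto

lemma word_cong_context:
  "word_cong A R u v \<Longrightarrow> p \<in> lists A \<Longrightarrow> q \<in> lists A \<Longrightarrow> word_cong A R (p @ u @ q) (p @ v @ q)"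
proof (induction rule: word_cong.induct)
  case (rel u v p' q')
  then show ?case
    using word_cong.rel[of u v R A "p @ p'" "q' @ q"] by auto
next
  case (refl w)
  then show ?case
    by (simp add: word_cong.refl)
next
  case (sym u v)
  then show ?case
    using word_cong.sym by blast
next
  case (trans u v w)
  then show ?case
    using word_cong.trans by blast
qed

lemma word_cong_append:
  assumes "word_cong A R u u'" "word_cong A R v v'"
  shows "word_cong A R (u @ v) (u' @ v')"
proof (rule word_cong.trans)
  show "word_cong A R (u @ v) (u' @ v)"
    using word_cong_context[OF assms(1), of "[]" v] word_cong_in_lists[OF assms(2)] by simp
  show "word_cong A R (u' @ v) (u' @ v')"
    using word_cong_context[OF assms(2), of u' "[]"] word_cong_in_lists[OF assms(1)] by simp
qed

lemma word_class_eqI: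
  assumes "word_cong A R u v"
  shows "word_class A R u = word_class A R v"
  unfolding word_class_def
  by (rule Collect_cong)
    (rule iffI, erule word_cong.trans[OF word_cong.sym[OF assms]], erule word_cong.trans[OF assms])

lemma presented_monoid_mult:
  assumes "u \<in> lists A" "v \<in> lists A"
  shows "word_class A R u \<otimes>\<^bsub>presented_monoid A R\<^esub> word_class A R v = word_class A R (u @ v)"
proof -
  have "word_class A R (x @ y) = word_class A R (u @ v)"
    if "x \<in> word_class A R u" "y \<in> word_class A R v" for x y
    using that word_class_eqI[OF word_cong_append, of A R u x v y]
    by (simp add: word_class_def)
  then have "(\<Union>x\<in>word_class A R u. \<Union>y\<in>word_class A R v. word_class A R (x @ y)) =
      (\<Union>x\<in>word_class A R u. \<Union>y\<in>word_class A R v. word_class A R (u @ v))"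
    by (intro SUP_cong) simp_all
  moreover have "word_class A R u \<noteq> {}" "word_class A R v \<noteq> {}"
    using assms word_cong.refl[of _ A R] by (auto simp only: word_class_def)
  ultimately show ?thesis
    by (simp add: presented_monoid_def)
qed

lemma monoid_presented_monoid: "Group.monoid (presented_monoid A R)"
proof -
  have car: "carrier (presented_monoid A R) = word_class A R ` lists A"
    and one: "\<one>\<^bsub>presented_monoid A R\<^esub> = word_class A R []"
    by (simp_all add: presented_monoid_def)
  have append: "u @ v \<in> lists A" if "u \<in> lists A" "v \<in> lists A" for u v
    using that by simp
  show ?thesis
  proof (rule monoidI)
    fix x y z
    assume "x \<in> carrier (presented_monoid A R)" "y \<in> carrier (presented_monoid A R)"
      "z \<in> carrier (presented_monoid A R)"
    then show "x \<otimes>\<^bsub>presented_monoid A R\<^esub> y \<otimes>\<^bsub>presented_monoid A R\<^esub> z =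
        x \<otimes>\<^bsub>presented_monoid A R\<^esub> (y \<otimes>\<^bsub>presented_monoid A R\<^esub> z)"
      unfolding car by (elim imageE) (simp only: presented_monoid_mult append append_assoc)
  next
    fix x y
    assume "x \<in> carrier (presented_monoid A R)" "y \<in> carrier (presented_monoid A R)"
    then show "x \<otimes>\<^bsub>presented_monoid A R\<^esub> y \<in> carrier (presented_monoid A R)"
      unfolding car by (elim imageE) (simp only: presented_monoid_mult append imageI)
  next
    show "\<one>\<^bsub>presented_monoid A R\<^esub> \<in> carrier (presented_monoid A R)"
      unfolding car one by (rule imageI) simp
  next
    fix x
    assume "x \<in> carrier (presented_monoid A R)"
    then obtain u where u: "u \<in> lists A" "x = word_class A R u"
      unfolding car by blast
    show "\<one>\<^bsub>presented_monoid A R\<^esub> \<otimes>\<^bsub>presented_monoid A R\<^esub> x = x"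
      "x \<otimes>\<^bsub>presented_monoid A R\<^esub> \<one>\<^bsub>presented_monoid A R\<^esub> = x"
      using presented_monoid_mult[of "[]" A u R] presented_monoid_mult[of u A "[]" R] u
      by (simp_all add: one)
  qed
qed

text \<open>
  In a not necessarily commutative monoid, \<open>a divides\<^bsub>M\<^esub> b\<close> from \<open>HOL-Algebra\<close> says that \<open>a\<close>
  divides \<open>b\<close> from the left (\<open>b = a \<otimes> c\<close> for some \<open>c\<close>), so that \<open>c lcmof\<^bsub>M\<^esub> a b\<close> says that \<open>c\<close>
  is a \<^emph>\<open>right\<close> least common multiple of \<open>a\<close> and \<open>b\<close>.  The following are the mirror images.
\<close>

definition divides_right :: "[('a, 'b) monoid_scheme, 'a, 'a] \<Rightarrow> bool" where
  "divides_right M a b \<longleftrightarrow> (\<exists>c\<in>carrier M. b = c \<otimes>\<^bsub>M\<^esub> a)"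

definition is_left_lcm :: "[('a, 'b) monoid_scheme, 'a, 'a, 'a] \<Rightarrow> bool" where
  "is_left_lcm M x a b \<longleftrightarrow> divides_right M a x \<and> divides_right M b x \<and>
     (\<forall>y\<in>carrier M. divides_right M a y \<and> divides_right M b y \<longrightarrow> divides_right M x y)"

datatype gen = Gen_s | Gen_t nat | Gen_u nat

definition gens :: "nat \<Rightarrow> nat \<Rightarrow> gen set" where
  "gens m n = {Gen_s} \<union> Gen_t ` {1..m} \<union> Gen_u ` {1..n}"

definition cyclic_rels :: "'a list \<Rightarrow> ('a list \<times> 'a list) set" where
  "cyclic_rels w = {(w, rotate i w) | i. i < length w}"

definition G_rels :: "nat \<Rightarrow> nat \<Rightarrow> (gen list \<times> gen list) set" where
  "G_rels m n =
     cyclic_rels (Gen_s # map Gen_t [1..<Suc m]) \<union>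
     cyclic_rels (Gen_s # map Gen_u [1..<Suc n]) \<union>
     (\<Union>i\<in>{1..m}. \<Union>j\<in>{1..n}. cyclic_rels [Gen_t i, Gen_u j])"

definition G_plus :: "nat \<Rightarrow> nat \<Rightarrow> gen list set monoid" where
  "G_plus m n = presented_monoid (gens m n) (G_rels m n)"

end

theory Submission
  imports Defs
begin

text \<open>
  Write \<open>T = t\<^sub>1 \<dots> t\<^sub>m\<close>.  Both \<open>s T\<close> and \<open>u\<^sub>1 T s\<close> are common right-multiples of \<open>t\<^sub>1\<close> and
  \<open>t\<^sub>2\<close>.  The class of \<open>s T\<close> consists of the rotations of that word, in which the last letter
  determines the first one; so if \<open>w\<close> is a common right-multiple of \<open>t\<^sub>1\<close> and \<open>t\<^sub>2\<close> and
  \<open>s T = w z\<close>, then \<open>z\<close> is empty, as rotations starting with \<open>t\<^sub>1\<close> and with \<open>t\<^sub>2\<close> end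
  differently.  But \<open>s T = T s\<close> does not divide \<open>u\<^sub>1 T s\<close>: erasing the letters \<open>t\<^sub>i\<close> would make
  \<open>s\<close> divide \<open>u\<^sub>1 s\<close> from the left, and since \<open>n \<ge> 2\<close> no relation applies to \<open>u\<^sub>1 s\<close>.
  The left-handed case is the same with \<open>s T u\<^sub>1\<close> in place of \<open>u\<^sub>1 T s\<close>.
\<close>

section \<open>Divisibility in a presented monoid, in terms of words\<close>

lemma word_class_eq_iff:
  assumes "v \<in> lists A"
  shows "word_class A R u = word_class A R v \<longleftrightarrow> word_cong A R u v"
  using word_class_eqI[of A R u v] word_cong.refl[OF assms, of R]
  by (auto simp: word_class_def)

lemma carrier_presented_monoid: "carrier (presented_monoid A R) = word_class A R ` lists A"
  by (simp add: presented_monoid_def)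

lemma divides_presented_monoid:
  assumes "u \<in> lists A" "v \<in> lists A"
  shows "word_class A R u divides\<^bsub>presented_monoid A R\<^esub> word_class A R v \<longleftrightarrow>
    (\<exists>w\<in>lists A. word_cong A R v (u @ w))"
proof -
  have "word_class A R v = word_class A R u \<otimes>\<^bsub>presented_monoid A R\<^esub> word_class A R w \<longleftrightarrow>
      word_cong A R v (u @ w)" if "w \<in> lists A" for w
    using that assms by (simp only: presented_monoid_mult word_class_eq_iff append_in_lists_conv)
  then show ?thesis
    by (auto simp: factor_def carrier_presented_monoid)
qed

lemma divides_right_presented_monoid:
  assumes "u \<in> lists A" "v \<in> lists A"
  shows "divides_right (presented_monoid A R) (word_class A R u) (word_class A R v) \<longleftrightarrow>
    (\<exists>w\<in>lists A. word_cong A R v (w @ u))"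
proof -
  have "word_class A R v = word_class A R w \<otimes>\<^bsub>presented_monoid A R\<^esub> word_class A R u \<longleftrightarrow>
      word_cong A R v (w @ u)" if "w \<in> lists A" for w
    using that assms by (simp only: presented_monoid_mult word_class_eq_iff append_in_lists_conv)
  then show ?thesis
    by (auto simp: divides_right_def carrier_presented_monoid)
qed

section \<open>Invariants of a congruence, and rotations of words\<close>

declare word_cong.trans [trans]

text \<open>Reduces the invariance of \<open>P\<close> to a single application of a relation in
  context. Both invariants that bound congruence classes below are proved through it.\<close>

lemma word_cong_closed:
  assumes "word_cong A R u v"
    and "\<And>x y p q. (x, y) \<in> R \<Longrightarrow> P (p @ x @ q) \<longleftrightarrow> P (p @ y @ q)"
  shows "P u \<longleftrightarrow> P v"
  using assms(1) by induction (auto simp: assms(2))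

text \<open>The head of a rotation is the letter at position \<open>i mod length xs\<close>. As the
  letters are distinct, it fixes the rotation.\<close>

lemma rotate_eq_if_hd_eq:
  assumes "distinct xs" "xs \<noteq> []" "hd (rotate i xs) = hd (rotate j xs)"
  shows "rotate i xs = rotate j xs"
proof -
  have "i mod length xs = j mod length xs"
    using assms by (simp add: hd_rotate_conv_nth nth_eq_iff_index_eq)
  then show ?thesis
    by (metis rotate_conv_mod)
qed

text \<open>The last letter of a rotation is the head of the rotation one step earlier, so the
  statement about heads applies.\<close>

lemma rotate_eq_if_last_eq:
  assumes "distinct xs" "xs \<noteq> []" "last (rotate i xs) = last (rotate j xs)"
  shows "rotate i xs = rotate j xs"
proof -
  \<comment> \<open>Modulo the length, \<open>k\<close> is -1: rotating by \<open>l + k\<close> goes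
    one step back from \<open>l\<close> without subtracting from \<open>l\<close>.\<close>
  define k where "k = length xs - 1"
  have rot: "rotate l xs = rotate1 (rotate (l + k) xs)" for l
  proof -
    have "rotate1 (rotate (l + k) xs) = rotate (l + length xs) xs"
      using assms(2) by (cases xs) (simp_all add: k_def)
    also have "\<dots> = rotate l xs"
      by (metis mod_add_self2 rotate_conv_mod)
    finally show ?thesis by simp
  qed
  have "last (rotate1 ys) = hd ys" if "ys \<noteq> []" for ys :: "'a list"
    using that by (cases ys) auto
  then have "last (rotate l xs) = hd (rotate (l + k) xs)" for l
    using assms(2) by (subst rot) simp
  then have "rotate (i + k) xs = rotate (j + k) xs"
    using assms by (intro rotate_eq_if_hd_eq) simp_all
  then show ?thesis
    using rot by metis
qed

lemma mset_filter_rotate: "mset (filter P (rotate i xs)) = mset (filter P xs)"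
proof -
  have "mset (rotate i xs) = mset xs"
    by (metis append_take_drop_id mset_append rotate_drop_take union_commute)
  then show ?thesis by simp
qed

declare One_nat_def [simp del] upt_Suc [simp del]

section \<open>The relations of \<open>G_plus\<close> and two invariants of their congruence\<close>

abbreviation st_word :: "nat \<Rightarrow> gen list" where
  "st_word m \<equiv> Gen_s # map Gen_t [1..<Suc m]"

text \<open>\<open>filter not_t\<close> is the homomorphism of free monoids that erases every
  \<open>t\<^sub>i\<close>.\<close>

definition not_t :: "gen \<Rightarrow> bool" where
  "not_t x \<longleftrightarrow> (\<forall>i. x \<noteq> Gen_t i)"

lemma not_t_simps [simp]: "not_t Gen_s" "not_t (Gen_u i)" "\<not> not_t (Gen_t i)"
  by (simp_all add: not_t_def)

lemma filter_not_t_simps [simp]: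
  "filter not_t (map Gen_t is) = []" "filter not_t (map Gen_u is) = map Gen_u is"
  by (induction "is") simp_all

lemma distinct_st_word: "distinct (st_word m)"
  by (auto simp: distinct_map inj_on_def)

text \<open>The ranges of the indices are dropped, since the invariants do not depend on them. The
  alternative \<open>y = x\<close> is the rotation by 0, which \<open>cyclic_rels\<close>
  includes.\<close>

lemma G_rels_cases:
  assumes "(x, y) \<in> G_rels m n"
  obtains (t) i where "x = st_word m" "y = rotate i (st_word m)"
  | (u) i where "x = Gen_s # map Gen_u [1..<Suc n]" "y = rotate i x"
  | (tu) i j where "x = [Gen_t i, Gen_u j]" "y = x \<or> y = [Gen_u j, Gen_t i]"
proof -
  consider "(x, y) \<in> cyclic_rels (st_word m)"
    | "(x, y) \<in> cyclic_rels (Gen_s # map Gen_u [1..<Suc n])"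
    | i j where "(x, y) \<in> cyclic_rels [Gen_t i, Gen_u j]"
    using assms by (auto simp only: G_rels_def Un_iff UN_iff)
  then show thesis
  proof cases
    case 1
    then show thesis
      using t by (auto simp only: cyclic_rels_def)
  next
    case 2
    then show thesis
      using u by (auto simp only: cyclic_rels_def)
  next
    case 3
    then obtain k where "k < length [Gen_t i, Gen_u j]" "x = [Gen_t i, Gen_u j]" "y = rotate k x"
      by (auto simp only: cyclic_rels_def)
    then show thesis
      using tu[of i j] by (auto simp: less_Suc_eq)
  qed
qed

lemma set_G_rels: "(x, y) \<in> G_rels m n \<Longrightarrow> set x = set y"
  by (erule G_rels_cases) (auto simp only: set_rotate set_simps)

text \<open>The set of rotations is closed under all relations. Those other than the cyclic ones of
  \<open>st_word m\<close> contain some \<open>u\<^sub>j\<close> on both sides (for the relations of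
  \<open>s\<close> and the \<open>u\<^sub>j\<close> by \<open>n \<ge> 1\<close>), which no rotation
  does; the remaining ones exchange whole rotations.\<close>

lemma word_cong_rotate_st_word:
  assumes cong: "word_cong (gens m n) (G_rels m n) (st_word m) w" and n: "n \<ge> 1"
  shows "\<exists>i. w = rotate i (st_word m)"
proof -
  define P where "P w \<longleftrightarrow> (\<exists>i. w = rotate i (st_word m))" for w
  have no_u: False if "P w" "Gen_u j \<in> set w" for w j
    using that by (auto simp: P_def)
  have len: "length w = Suc m" if "P w" for w
    using that by (auto simp: P_def)
  have "P (p @ x @ q) \<longleftrightarrow> P (p @ y @ q)" if "(x, y) \<in> G_rels m n" for x y p q
    using that
  proof (cases rule: G_rels_cases)
    case (t i)
    then have "P x" "P y"
      by (auto simp: P_def intro: exI[of _ 0])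
    \<comment> \<open>\<open>x\<close> and \<open>y\<close> already have the full length
      \<open>Suc m\<close>, so no context is left around them.\<close>
    moreover from this have "p = [] \<and> q = []" if "P (p @ z @ q)" "z \<in> {x, y}" for z
      using len[OF that(1)] that(2) len[of x] len[of y] by auto
    ultimately show ?thesis
      by (metis append_Nil append_Nil2 insertCI)
  next
    case (u i)
    then have "Gen_u 1 \<in> set x"
      using n by auto
    then show ?thesis
      using no_u[of "p @ x @ q" 1] no_u[of "p @ y @ q" 1] set_G_rels[OF that] by auto
  next
    case (tu i j)
    then have "Gen_u j \<in> set x" by simp
    then show ?thesis
      using no_u[of "p @ x @ q" j] no_u[of "p @ y @ q" j] set_G_rels[OF that] by auto
  qed
  then have "P (st_word m) \<longleftrightarrow> P w"
    by (rule word_cong_closed[OF cong])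
  moreover have "P (st_word m)"
    unfolding P_def by (rule exI[of _ 0]) simp
  ultimately show ?thesis
    by (simp add: P_def)
qed

text \<open>
  Only the relations \<open>[s, u\<^sub>1, \<dots>, u\<^sub>n]\<close> survive the erasure of the \<open>t\<^sub>i\<close>, and they
  are too long to apply to a word of two letters.
\<close>
lemma word_cong_filter_not_t:
  assumes cong: "word_cong (gens m n) (G_rels m n) v w" and n: "n \<ge> 2"
    and v: "length (filter not_t v) = 2"
  shows "filter not_t w = filter not_t v"
proof -
  define P where "P w \<longleftrightarrow> filter not_t w = filter not_t v" for w
  have "P (p @ x @ q) \<longleftrightarrow> P (p @ y @ q)" if "(x, y) \<in> G_rels m n" for x y p q
    using that
  proof (cases rule: G_rels_cases)
    case (t i)
    \<comment> \<open>Erasure leaves only \<open>s\<close> on either side, so this relation becomes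
      trivial.\<close>
    then have "filter not_t x = [Gen_s]" by simp
    moreover from this t have "filter not_t y = [Gen_s]"
      using mset_filter_rotate[of not_t i x] by (metis mset.simps(1,2) mset_single_iff_right)
    ultimately show ?thesis
      by (simp add: P_def)
  next
    case (u i)
    then have "length (filter not_t y) = length (filter not_t x)"
      using mset_filter_rotate[of not_t i x] by (metis size_mset)
    \<comment> \<open>Nothing is erased from \<open>x\<close>, whose length is \<open>n + 1\<close>.
      Hence both sides of the equivalence are false.\<close>
    moreover have "length (filter not_t x) > 2"
      using u n by simp
    ultimately have "length (filter not_t z) > 2" if "z \<in> {x, y}" for z
      using that by auto
    then have "length (filter not_t (p @ z @ q)) > 2" if "z \<in> {x, y}" for z
      using that by fastforce
    then have "\<not> P (p @ z @ q)" if "z \<in> {x, y}" for z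
      using that v by (metis P_def less_irrefl)
    then show ?thesis by simp
  next
    case (tu i j)
    then show ?thesis
      by (auto simp: P_def)
  qed
  then have "P v \<longleftrightarrow> P w"
    by (rule word_cong_closed[OF cong])
  then show ?thesis
    by (simp add: P_def)
qed

section \<open>Explicit congruences between words\<close>

lemma st_word_eq:
  assumes "m \<ge> 2"
  shows "st_word m = Gen_s # Gen_t 1 # Gen_t 2 # map Gen_t [3..<Suc m]"
  using assms by (simp add: upt_conv_Cons numeral_eq_Suc)

lemma word_cong_st_word_rotate:
  assumes "i \<le> m"
  shows "word_cong (gens m n) (G_rels m n) (st_word m) (rotate i (st_word m))"
proof -
  have "(st_word m, rotate i (st_word m)) \<in> cyclic_rels (st_word m)"
    using assms unfolding cyclic_rels_def by auto
  then have "(st_word m, rotate i (st_word m)) \<in> G_rels m n"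
    by (simp add: G_rels_def)
  moreover have "st_word m \<in> lists (gens m n)" "rotate i (st_word m) \<in> lists (gens m n)"
    by (auto simp: gens_def in_lists_conv_set)
  ultimately show ?thesis
    using word_cong.rel[of _ _ "G_rels m n" "gens m n" "[]" "[]"] by simp
qed

lemma word_cong_t_u:
  assumes "i \<in> {1..m}" "j \<in> {1..n}"
  shows "word_cong (gens m n) (G_rels m n) [Gen_t i, Gen_u j] [Gen_u j, Gen_t i]"
proof -
  have "([Gen_t i, Gen_u j], [Gen_u j, Gen_t i]) \<in> cyclic_rels [Gen_t i, Gen_u j]"
    unfolding cyclic_rels_def by (auto simp: One_nat_def intro!: exI[of _ 1])
  then have "([Gen_t i, Gen_u j], [Gen_u j, Gen_t i]) \<in> G_rels m n"
    using assms by (auto simp: G_rels_def)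
  then show ?thesis
    using word_cong.rel[of _ _ "G_rels m n" "gens m n" "[]" "[]"] assms by (auto simp: gens_def)
qed

section \<open>Common multiples of \<open>t\<^sub>1\<close> and \<open>t\<^sub>2\<close>\<close>

context
  fixes m n :: nat
  assumes mn: "m \<ge> 2" "n \<ge> 2"
begin

abbreviation (input) cong (infix "\<approx>" 50) where
  "v \<approx> w \<equiv> word_cong (gens m n) (G_rels m n) v w"

abbreviation (input) "tail_t \<equiv> map Gen_t [3..<Suc m]"

lemma gens_mem: "Gen_s \<in> gens m n" "Gen_t 1 \<in> gens m n" "Gen_t 2 \<in> gens m n"
  "Gen_u 1 \<in> gens m n" "set tail_t \<subseteq> gens m n"
  using mn by (auto simp: gens_def)

text \<open>The first two show \<open>s T\<close> as a right-multiple of \<open>t\<^sub>1\<close>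
  and \<open>t\<^sub>2\<close>, the last two as a left-multiple of both.\<close>

lemma rotations:
  "Gen_s # Gen_t 1 # Gen_t 2 # tail_t \<approx> Gen_t 1 # Gen_t 2 # tail_t @ [Gen_s]"
  "Gen_s # Gen_t 1 # Gen_t 2 # tail_t \<approx> Gen_t 2 # tail_t @ [Gen_s, Gen_t 1]"
  "Gen_s # Gen_t 1 # Gen_t 2 # tail_t \<approx> tail_t @ [Gen_s, Gen_t 1, Gen_t 2]"
proof -
  have 1: "rotate 1 (Gen_s # Gen_t 1 # Gen_t 2 # tail_t) = Gen_t 1 # Gen_t 2 # tail_t @ [Gen_s]"
    by (simp add: One_nat_def)
  have 3: "rotate 3 (Gen_s # Gen_t 1 # Gen_t 2 # tail_t) = tail_t @ [Gen_s, Gen_t 1, Gen_t 2]"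
    by (simp add: numeral_eq_Suc)
  show "Gen_s # Gen_t 1 # Gen_t 2 # tail_t \<approx> Gen_t 1 # Gen_t 2 # tail_t @ [Gen_s]"
    using word_cong_st_word_rotate[of 1 m n] mn 1 by (simp add: st_word_eq)
  show "Gen_s # Gen_t 1 # Gen_t 2 # tail_t \<approx> Gen_t 2 # tail_t @ [Gen_s, Gen_t 1]"
    using word_cong_st_word_rotate[of 2 m n] mn by (simp add: st_word_eq numeral_eq_Suc)
  show "Gen_s # Gen_t 1 # Gen_t 2 # tail_t \<approx> tail_t @ [Gen_s, Gen_t 1, Gen_t 2]"
  \<comment> \<open>For \<open>m = 2\<close> the word has length 3, so rotating by 3 is beyond the
    bound \<open>i \<le> m\<close>; but then \<open>tail_t\<close> is empty and both words
    coincide.\<close>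
  proof (cases "m = 2")
    case True
    then show ?thesis
      using gens_mem by (auto intro!: word_cong.refl)
  next
    case False
    then show ?thesis
      using word_cong_st_word_rotate[of 3 m n] mn 3 by (simp add: st_word_eq)
  qed
qed

text \<open>To bring a chosen \<open>t\<^sub>i\<close> to the end where \<open>u\<^sub>1\<close>
  stands, rotate the rest of the word if necessary until \<open>t\<^sub>i\<close> is next to
  \<open>u\<^sub>1\<close>, then commute the two. The first two congruences serve right-multiples,
  the last two left-multiples.\<close>

lemma rotations_u:
  "Gen_u 1 # Gen_t 1 # Gen_t 2 # tail_t @ [Gen_s] \<approx> Gen_t 1 # Gen_u 1 # Gen_t 2 # tail_t @ [Gen_s]"
  "Gen_u 1 # Gen_t 1 # Gen_t 2 # tail_t @ [Gen_s] \<approx> Gen_t 2 # Gen_u 1 # tail_t @ [Gen_s, Gen_t 1]"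
  "Gen_s # Gen_t 1 # Gen_t 2 # tail_t @ [Gen_u 1] \<approx> Gen_t 2 # tail_t @ [Gen_s, Gen_u 1, Gen_t 1]"
  "Gen_s # Gen_t 1 # Gen_t 2 # tail_t @ [Gen_u 1] \<approx> tail_t @ [Gen_s, Gen_t 1, Gen_u 1, Gen_t 2]"
proof -
  have u: "p @ [Gen_t i, Gen_u 1] @ q \<approx> p @ [Gen_u 1, Gen_t i] @ q"
    if "i = 1 \<or> i = 2" "set p \<subseteq> gens m n" "set q \<subseteq> gens m n" for i p q
    using word_cong_context[OF word_cong_t_u[of i m 1 n], of p q] that mn
    by (auto simp: in_lists_conv_set subset_iff)
  have l: "Gen_u 1 # v \<approx> Gen_u 1 # w" and r: "v @ [Gen_u 1] \<approx> w @ [Gen_u 1]" if "v \<approx> w" for v w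
    using word_cong_context[OF that, of "[Gen_u 1]" "[]"] word_cong_context[OF that, of "[]" "[Gen_u 1]"]
      gens_mem by simp_all
  show "Gen_u 1 # Gen_t 1 # Gen_t 2 # tail_t @ [Gen_s] \<approx> Gen_t 1 # Gen_u 1 # Gen_t 2 # tail_t @ [Gen_s]"
    using u[of 1 "[]" "Gen_t 2 # tail_t @ [Gen_s]"] gens_mem by (simp add: word_cong.sym)
  have "Gen_u 1 # Gen_t 1 # Gen_t 2 # tail_t @ [Gen_s] \<approx> Gen_u 1 # Gen_t 2 # tail_t @ [Gen_s, Gen_t 1]"
    \<comment> \<open>Behind \<open>u\<^sub>1\<close> stand two rotations of \<open>s T\<close>,
      congruent to each other through \<open>s T\<close>.\<close>
    by (rule l, rule word_cong.trans[OF word_cong.sym]) (rule rotations)+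
  also have "\<dots> \<approx> Gen_t 2 # Gen_u 1 # tail_t @ [Gen_s, Gen_t 1]"
    using u[of 2 "[]" "tail_t @ [Gen_s, Gen_t 1]"] gens_mem by (simp add: word_cong.sym)
  finally show "Gen_u 1 # Gen_t 1 # Gen_t 2 # tail_t @ [Gen_s] \<approx>
      Gen_t 2 # Gen_u 1 # tail_t @ [Gen_s, Gen_t 1]" .
  have "Gen_s # Gen_t 1 # Gen_t 2 # tail_t @ [Gen_u 1] \<approx> Gen_t 2 # tail_t @ [Gen_s, Gen_t 1, Gen_u 1]"
    using r[OF rotations(2)] by simp
  also have "\<dots> \<approx> Gen_t 2 # tail_t @ [Gen_s, Gen_u 1, Gen_t 1]"
    using u[of 1 "Gen_t 2 # tail_t @ [Gen_s]" "[]"] gens_mem by simp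
  finally show "Gen_s # Gen_t 1 # Gen_t 2 # tail_t @ [Gen_u 1] \<approx>
      Gen_t 2 # tail_t @ [Gen_s, Gen_u 1, Gen_t 1]" .
  have "Gen_s # Gen_t 1 # Gen_t 2 # tail_t @ [Gen_u 1] \<approx> tail_t @ [Gen_s, Gen_t 1, Gen_t 2, Gen_u 1]"
    using r[OF rotations(3)] by simp
  also have "\<dots> \<approx> tail_t @ [Gen_s, Gen_t 1, Gen_u 1, Gen_t 2]"
    using u[of 2 "tail_t @ [Gen_s, Gen_t 1]" "[]"] gens_mem by simp
  finally show "Gen_s # Gen_t 1 # Gen_t 2 # tail_t @ [Gen_u 1] \<approx>
      tail_t @ [Gen_s, Gen_t 1, Gen_u 1, Gen_t 2]" .
qed

text \<open>The hypotheses spell out on words that \<open>w\<close> is a common right-multiple of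
  \<open>t\<^sub>1\<close> and \<open>t\<^sub>2\<close> dividing both \<open>s T\<close> and
  \<open>u\<^sub>1 T s\<close> from the left.\<close>

lemma no_right_lcm:
  assumes w1: "w \<approx> Gen_t 1 # p" and w2: "w \<approx> Gen_t 2 # q" and z: "st_word m \<approx> w @ z"
    and y: "Gen_u 1 # Gen_t 1 # Gen_t 2 # tail_t @ [Gen_s] \<approx> w @ y"
  shows False
proof -
  have "z \<in> lists (gens m n)" "y \<in> lists (gens m n)"
    using word_cong_in_lists[OF z] word_cong_in_lists[OF y] by auto
  note append = word_cong_append[OF _ word_cong.refl[OF this(1)]]
    and append' = word_cong_append[OF _ word_cong.refl[OF this(2)]]
  obtain i where i: "Gen_t 1 # p @ z = rotate i (st_word m)"
    using word_cong_rotate_st_word[OF word_cong.trans[OF z append[OF w1]]] mn by auto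
  obtain j where j: "Gen_t 2 # q @ z = rotate j (st_word m)"
    using word_cong_rotate_st_word[OF word_cong.trans[OF z append[OF w2]]] mn by auto
  have "z = []"
  proof (rule ccontr)
    assume "z \<noteq> []"
    then have "last (rotate i (st_word m)) = last (rotate j (st_word m))"
      by (simp flip: i j)
    then have "rotate i (st_word m) = rotate j (st_word m)"
      by (intro rotate_eq_if_last_eq distinct_st_word) simp_all
    then show False
      by (simp flip: i j)
  qed
  then have "w \<approx> st_word m"
    using z by (simp add: word_cong.sym)
  then have "Gen_u 1 # Gen_t 1 # Gen_t 2 # tail_t @ [Gen_s] \<approx> st_word m @ y"
    by (intro word_cong.trans[OF y append'])
  \<comment> \<open>Erasing the \<open>t\<^sub>i\<close> leaves \<open>u\<^sub>1 s\<close> on the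
    left, but a word starting with \<open>s\<close> on the right.\<close>
  then show False
    using word_cong_filter_not_t[of m n] mn by fastforce
qed

text \<open>Mirror image: a nonempty \<open>z\<close> would give rotations ending in
  \<open>t\<^sub>1\<close> and in \<open>t\<^sub>2\<close> the same first letter.\<close>

lemma no_left_lcm:
  assumes w1: "w \<approx> p @ [Gen_t 1]" and w2: "w \<approx> q @ [Gen_t 2]" and z: "st_word m \<approx> z @ w"
    and y: "Gen_s # Gen_t 1 # Gen_t 2 # tail_t @ [Gen_u 1] \<approx> y @ w"
  shows False
proof -
  have "z \<in> lists (gens m n)" "y \<in> lists (gens m n)"
    using word_cong_in_lists[OF z] word_cong_in_lists[OF y] by auto
  note append = word_cong_append[OF word_cong.refl[OF this(1)]]
    and append' = word_cong_append[OF word_cong.refl[OF this(2)]]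
  obtain i where i: "z @ p @ [Gen_t 1] = rotate i (st_word m)"
    using word_cong_rotate_st_word[OF word_cong.trans[OF z append[OF w1]]] mn by auto
  obtain j where j: "z @ q @ [Gen_t 2] = rotate j (st_word m)"
    using word_cong_rotate_st_word[OF word_cong.trans[OF z append[OF w2]]] mn by auto
  have "z = []"
  proof (rule ccontr)
    assume "z \<noteq> []"
    then have "hd (rotate i (st_word m)) = hd (rotate j (st_word m))"
      by (simp flip: i j)
    then have "rotate i (st_word m) = rotate j (st_word m)"
      by (intro rotate_eq_if_hd_eq distinct_st_word) simp_all
    then show False
      by (simp flip: i j)
  qed
  then have "w \<approx> Gen_t 1 # Gen_t 2 # tail_t @ [Gen_s]"
    using z word_cong.trans[OF word_cong.sym rotations(1)] mn by (simp add: st_word_eq)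
  then have "Gen_s # Gen_t 1 # Gen_t 2 # tail_t @ [Gen_u 1] \<approx>
      y @ Gen_t 1 # Gen_t 2 # tail_t @ [Gen_s]"
    by (intro word_cong.trans[OF y append'])
  \<comment> \<open>After erasure the left side is \<open>s u\<^sub>1\<close>, while the right side
    ends in \<open>s\<close>.\<close>
  then show False
    using word_cong_filter_not_t[of m n] mn by fastforce
qed

end

section \<open>From words back to elements of the monoid\<close>

theorem proposition5p3:
  fixes m n :: nat
  assumes "m \<ge> 2" and "n \<ge> 2"
  shows "(\<exists>a\<in>carrier (G_plus m n). \<exists>b\<in>carrier (G_plus m n).
            \<not> (\<exists>c\<in>carrier (G_plus m n). c lcmof\<^bsub>G_plus m n\<^esub> a b)) \<and>
         (\<exists>a\<in>carrier (G_plus m n). \<exists>b\<in>carrier (G_plus m n).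
            \<not> (\<exists>c\<in>carrier (G_plus m n). is_left_lcm (G_plus m n) c a b))"
proof -
  let ?A = "gens m n" and ?R = "G_rels m n"
  let ?cl = "word_class ?A ?R" and ?T = "map Gen_t [3..<Suc m]"
  let ?st = "Gen_s # Gen_t 1 # Gen_t 2 # ?T"
  let ?ut = "Gen_u 1 # Gen_t 1 # Gen_t 2 # ?T @ [Gen_s]"
  let ?tu = "Gen_s # Gen_t 1 # Gen_t 2 # ?T @ [Gen_u 1]"
  note mem = gens_mem[OF assms] and rot = rotations[OF assms] rotations_u[OF assms]
  have carrier: "?cl w \<in> carrier (G_plus m n)" if "w \<in> lists ?A" for w
    using that by (simp add: G_plus_def carrier_presented_monoid)
  have lists: "[Gen_t 1] \<in> lists ?A" "[Gen_t 2] \<in> lists ?A" "?st \<in> lists ?A"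
    "?ut \<in> lists ?A" "?tu \<in> lists ?A"
    using mem by (auto simp: in_lists_conv_set)
  have div: "?cl v divides\<^bsub>G_plus m n\<^esub> ?cl w \<longleftrightarrow> (\<exists>x\<in>lists ?A. word_cong ?A ?R w (v @ x))"
    and div_right: "divides_right (G_plus m n) (?cl v) (?cl w) \<longleftrightarrow> (\<exists>x\<in>lists ?A. word_cong ?A ?R w (x @ v))"
    if "v \<in> lists ?A" "w \<in> lists ?A" for v w
    using that by (simp_all add: G_plus_def divides_presented_monoid divides_right_presented_monoid)
  have divI: "?cl v divides\<^bsub>G_plus m n\<^esub> ?cl w" if "word_cong ?A ?R w (v @ x)" for v w x
    using that div word_cong_in_lists[OF that] by auto
  have div_rightI: "divides_right (G_plus m n) (?cl v) (?cl w)" if "word_cong ?A ?R w (x @ v)" for v w x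
    using that div_right word_cong_in_lists[OF that] by auto
  \<comment> \<open>Every element of the carrier is the class of a word, so it suffices to exclude
    the classes \<open>?cl w\<close>.\<close>
  have "\<not> ?cl w lcmof\<^bsub>G_plus m n\<^esub> ?cl [Gen_t 1] ?cl [Gen_t 2]" if w: "w \<in> lists ?A" for w
  proof
    assume lcm: "?cl w lcmof\<^bsub>G_plus m n\<^esub> ?cl [Gen_t 1] ?cl [Gen_t 2]"
    then obtain p q where "word_cong ?A ?R w (Gen_t 1 # p)" "word_cong ?A ?R w (Gen_t 2 # q)"
      using w lists by (auto simp: islcm_def div simp del: in_lists_conv_set)
    moreover have "?cl w divides\<^bsub>G_plus m n\<^esub> ?cl x"
      if "word_cong ?A ?R x ([Gen_t 1] @ p)" "word_cong ?A ?R x ([Gen_t 2] @ q)" for x p q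
      using lcm divI[OF that(1)] divI[OF that(2)] carrier word_cong_in_lists[OF that(1)]
      by (simp add: islcm_def)
    then have "?cl w divides\<^bsub>G_plus m n\<^esub> ?cl ?st" "?cl w divides\<^bsub>G_plus m n\<^esub> ?cl ?ut"
      using rot by simp_all
    ultimately show False
      using no_right_lcm[OF assms, of w] lists w by (auto simp only: div st_word_eq[OF assms(1)])
  qed
  moreover have "\<not> is_left_lcm (G_plus m n) (?cl w) (?cl [Gen_t 1]) (?cl [Gen_t 2])"
    if w: "w \<in> lists ?A" for w
  proof
    assume lcm: "is_left_lcm (G_plus m n) (?cl w) (?cl [Gen_t 1]) (?cl [Gen_t 2])"
    then obtain p q where "word_cong ?A ?R w (p @ [Gen_t 1])" "word_cong ?A ?R w (q @ [Gen_t 2])"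
      using w lists by (auto simp: is_left_lcm_def div_right)
    moreover have "divides_right (G_plus m n) (?cl w) (?cl x)"
      if "word_cong ?A ?R x (p @ [Gen_t 1])" "word_cong ?A ?R x (q @ [Gen_t 2])" for x p q
      using lcm div_rightI[OF that(1)] div_rightI[OF that(2)] carrier word_cong_in_lists[OF that(1)]
      by (simp add: is_left_lcm_def)
    \<comment> \<open>The left cofactors are the words of \<open>rotations\<close> and
      \<open>rotations_u\<close> without their last letter \<open>t\<^sub>1\<close> or
      \<open>t\<^sub>2\<close>.\<close>
    from this[of ?st "Gen_t 2 # ?T @ [Gen_s]" "?T @ [Gen_s, Gen_t 1]"]
      this[of ?tu "Gen_t 2 # ?T @ [Gen_s, Gen_u 1]" "?T @ [Gen_s, Gen_t 1, Gen_u 1]"]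
    have "divides_right (G_plus m n) (?cl w) (?cl ?st)" "divides_right (G_plus m n) (?cl w) (?cl ?tu)"
      using rot by simp_all
    ultimately show False
      using no_left_lcm[OF assms, of w] lists w by (auto simp only: div_right st_word_eq[OF assms(1)])
  qed
  ultimately show ?thesis
    using carrier[OF lists(1)] carrier[OF lists(2)]
    by (intro conjI bexI[of _ "?cl [Gen_t 1]"] bexI[of _ "?cl [Gen_t 2]"])
      (auto simp: G_plus_def carrier_presented_monoid)
qed

end
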